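(* Let $a,b$ be two positive real numbers such that $a/(a+b)$ is not dyadic, and let $T=T_{-a}\wedge T_b$ be the hitting time of $\{-a,b\}$. Let $Q$ be a probability measure on $(\mathbb W,\mathcal W)$. If $0\in\mathcal T_Q$ and $T\in\mathcal T_Q$, then, for every finite stopping time $S$ in the canonical filtration of $\mathbb W$ such that the stopped process $X_{\cdot\wedge S}$ is uniformly bounded, one has $$|\mathbb E_Q[X_S]|\le a+b.$$
   Context: $\mathbb W$ is the set of all continuous functions $w:\mathbb R_+\to\mathbb R$ with $w(0)=0$; $\mathcal W$ is the $\sigma$-field on $\mathbb W$ generated by the canonical projections; $X=(X_t)_{t\ge0}$ is the coordinate process, $X_t(w)=w(t)$; $\mathcal F^0=(\mathcal F^0_t)_{t\ge 0}$ is the natural filtration of $X$, without any completion (the canonical filtration of $\mathbb W$). Stopping times are stopping times of $\mathcal F^0$, with values in $[0,+\infty]$. For $c\in\mathbb R$, $T_c(w)=\inf\{t\ge0:w(t)=c\}$ (with $\inf\emptyset=+\infty$). For a stopping time $R$, the reflection $\varrho_R:\mathbb W\to\mathbb W$ is defined by $\varrho_R(w)(t)=w(t)$ if $t\le R(w)$ and $\varrho_R(w)(t)=2w(R(w))-w(t)$ if $t\ge R(w)$ (so $\varrho_R(w)=w$ if $R(w)=+\infty$). $\mathcal T_Q$ is the set of all $\mathcal F^0$-stopping times $R$ such that $\varrho_R$ preserves $Q$, i.e. the image of $Q$ under $\varrho_R$ is $Q$; $0$ denotes the stopping time identically equal to $0$. $\mathbb E_Q$ is the expectation with respect to $Q$.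 A real number is dyadic if it is of the form $k/2^p$ with $k\in\mathbb Z$ and $p\in\mathbb N$. "Finite" means $S(w)<+\infty$ for every $w\in\mathbb W$, and "uniformly bounded" means that there is a constant $C$ such that $|X_{t\wedge S}(w)|\le C$ for every $t\in\mathbb R_+$ and $w\in\mathbb W$. *)

theory Defs
  imports "HOL-Probability.Probability"
begin

text \<open>
  A path is a function on the half-line \<open>{0..}\<close>.  It is represented by a total function that is
  \<open>undefined\<close> on the negative reals, so that distinct representatives are distinct paths.
\<close>

type_synonym path = "real \<Rightarrow> real"

definition paths :: "path set" where
  "paths = {w \<in> extensional {0..}. continuous_on {0..} w \<and> w 0 = 0}"

abbreviation (input) X :: "real \<Rightarrow> path \<Rightarrow> real" where
  "X t w \<equiv> w t"

definition path_space :: "path measure" where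
  "path_space = sigma paths {{w \<in> paths. X t w \<in> A} | t A. 0 \<le> t \<and> A \<in> sets borel}"

text \<open>
  The uncompleted natural filtration of the coordinate process.  It is indexed by \<open>ennreal\<close> rather
  than by the finite times only, because \<^const>\<open>stopping_time\<close> uses one type for the index set and
  for the values of stopping times.  This imposes no further condition: the condition at
  \<open>\<top>\<close> is \<open>{w. R w \<le> \<top>} \<in> sets (canonical_filtration \<top>)\<close>, which always holds.
\<close>

definition canonical_filtration :: "ennreal \<Rightarrow> path measure" where
  "canonical_filtration t =
     sigma paths {{w \<in> paths. X s w \<in> A} | s A. 0 \<le> s \<and> ennreal s \<le> t \<and> A \<in> sets borel}"

definition hitting_time :: "real \<Rightarrow> path \<Rightarrow> ennreal" where
  "hitting_time c w = (INF t\<in>{t. 0 \<le> t \<and> X t w = c}. ennreal t)"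

definition stopped_value :: "(path \<Rightarrow> ennreal) \<Rightarrow> path \<Rightarrow> real" where
  "stopped_value R w = X (enn2real (R w)) w" \<comment> \<open>meaningful only if \<open>R w < \<top>\<close>\<close>

definition reflection :: "(path \<Rightarrow> ennreal) \<Rightarrow> path \<Rightarrow> path" where
  "reflection R w =
     (\<lambda>t\<in>{0..}. if ennreal t \<le> R w then X t w else 2 * stopped_value R w - X t w)"

text \<open>
  The value of a stopping time outside \<^const>\<open>paths\<close> is irrelevant here and everywhere below.
\<close>

definition preserving_times :: "path measure \<Rightarrow> (path \<Rightarrow> ennreal) set" where
  "preserving_times Q =
     {R. stopping_time canonical_filtration R \<and> distr Q path_space (reflection R) = Q}"

definition dyadic :: "real \<Rightarrow> bool" where
  "dyadic x \<longleftrightarrow> (\<exists>(k::int) (p::nat). x = of_int k / 2 ^ p)"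

definition finite_time :: "(path \<Rightarrow> ennreal) \<Rightarrow> bool" where
  "finite_time S \<longleftrightarrow> (\<forall>w\<in>paths. S w < \<top>)"

definition stopped_uniformly_bounded :: "(path \<Rightarrow> ennreal) \<Rightarrow> bool" where
  "stopped_uniformly_bounded S \<longleftrightarrow>
     (\<exists>C. \<forall>w\<in>paths. \<forall>t\<ge>0. \<bar>stopped_value (\<lambda>w. min (ennreal t) (S w)) w\<bar> \<le> C)"

lemma space_path_space: "space path_space = paths"
  unfolding path_space_def by (rule space_measure_of) auto

lemma space_canonical_filtration: "space (canonical_filtration t) = paths"
  unfolding canonical_filtration_def by (rule space_measure_of) auto

lemma filtration_canonical_filtration: "filtration paths canonical_filtration"
proof
  show "space (canonical_filtration t) = paths" for t
    by (rule space_canonical_filtration)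
  show "sets (canonical_filtration s) \<le> sets (canonical_filtration t)" if "s \<le> t" for s t
  proof -
    have "sets (canonical_filtration t) =
        sigma_sets paths {{w \<in> paths. X s w \<in> A} | s A. 0 \<le> s \<and> ennreal s \<le> t \<and> A \<in> sets borel}" for t
      unfolding canonical_filtration_def by (rule sets_measure_of) auto
    then show ?thesis
      using that by simp (rule sigma_sets_mono', blast intro: order_trans)
  qed
qed

lemma sets_canonical_filtration_top: "sets (canonical_filtration \<top>) = sets path_space"
  unfolding canonical_filtration_def path_space_def by simp

end

theory Submission
  imports Defs
begin

text \<open>
  From a point of \<open>]-a, b[\<close>, let the path move until its displacement equals the distance to the
  nearer endpoint: it either exits at that endpoint or arrives at the mirror image of the
  endpoint.  As \<open>a / (a + b)\<close> is not dyadic, the latter never is the other endpoint, so the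
  successive points \<open>pos n\<close> reached without exit and the radii \<open>gap n\<close> are well defined, and
  they cut the path at times \<open>times n\<close> into increments of size \<open>gap n\<close>.  The product
  of the reflections at \<open>0\<close> and \<open>T\<close> flips the increments up to the first one that exits: it acts
  on their signs as a binary odometer.  Hence its \<open>2^n\<close>-th power fixes the path up to
  \<open>times n\<close> and flips the next increment, so under \<open>Q\<close> the values of the path at the \<open>times n\<close>
  form a martingale.  Stopped at the first of these times that is not before \<open>S\<close>, it differs
  from \<open>X_S\<close> by at most \<open>2 * gap n \<le> a + b\<close>.  These times are unbounded because \<open>gap\<close>
  doubles whenever it is small.
\<close>

section \<open>Path space\<close>

lemma pathsD:
  assumes "w \<in> paths"
  shows "continuous_on {0..} w" "w 0 = 0" "w \<in> extensional {0..}"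
  using assms by (auto simp: paths_def)

lemma paths_eqI:
  assumes "v \<in> extensional {0..}" "w \<in> extensional {0..}" "\<And>t. 0 \<le> t \<Longrightarrow> v t = (w t :: real)"
  shows "v = w"
  using assms by (intro extensionalityI[of _ "{0..}"]) auto

lemma sets_path_space:
  "sets path_space = sigma_sets paths {{w \<in> paths. w t \<in> A} | t A. 0 \<le> t \<and> A \<in> sets borel}"
  unfolding path_space_def by (rule sets_measure_of) auto

lemma measurable_coordinate [measurable]: "(\<lambda>w. w t) \<in> borel_measurable path_space"
proof (cases "0 \<le> t")
  case True
  show ?thesis
  proof (rule measurableI)
    fix A :: "real set" assume "A \<in> sets borel"
    then have "{w \<in> paths. w t \<in> A} \<in> sets path_space"
      unfolding sets_path_space using True by (intro sigma_sets.Basic) auto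
    moreover have "(\<lambda>w. w t) -` A \<inter> space path_space = {w \<in> paths. w t \<in> A}"
      by (auto simp: space_path_space)
    ultimately show "(\<lambda>w. w t) -` A \<inter> space path_space \<in> sets path_space" by simp
  qed simp
next
  case False
  \<comment> \<open>Paths are extensional, so at a negative time all of them take the same value
    \<open>undefined\<close>.\<close>
  have "(\<lambda>w. w t) \<in> borel_measurable path_space \<longleftrightarrow>
      (\<lambda>w. undefined :: real) \<in> borel_measurable path_space"
    using False by (intro measurable_cong) (auto simp: space_path_space paths_def extensional_def)
  then show ?thesis by simp
qed

lemma measurable_into_path_space:
  assumes "\<And>x. x \<in> space M \<Longrightarrow> f x \<in> paths"
    and "\<And>t. 0 \<le> t \<Longrightarrow> (\<lambda>x. f x t) \<in> borel_measurable M"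
  shows "f \<in> measurable M path_space"
  unfolding path_space_def
proof (rule measurable_measure_of)
  show "f \<in> space M \<rightarrow> paths" using assms(1) by auto
next
  fix y assume "y \<in> {{w \<in> paths. w t \<in> A} | t A. 0 \<le> t \<and> A \<in> sets (borel :: real measure)}"
  then obtain t and A :: "real set" where y: "y = {w \<in> paths. w t \<in> A}" "0 \<le> t" "A \<in> sets borel"
    by auto
  have "f -` y \<inter> space M = (\<lambda>x. f x t) -` A \<inter> space M"
    using assms(1) y by auto
  then show "f -` y \<inter> space M \<in> sets M"
    using measurable_sets[OF assms(2) y(3)] y(2) by simp
qed auto

text \<open>\<open>R\<close> is approximated from below by the discrete times
  \<open>r n w / Suc n\<close>. At these the value is a countable patchwork of coordinates, and
  continuity of the path gives the limit. Where \<open>R\<close> is infinite,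
  \<open>enn2real\<close> makes the value that at time 0.\<close>

lemma measurable_stopped_value [measurable]:
  assumes [measurable]: "R \<in> borel_measurable path_space"
  shows "stopped_value R \<in> borel_measurable path_space"
proof -
  define r where "r n w = nat \<lfloor>real (Suc n) * enn2real (R w)\<rfloor>" for n w
  have [measurable]: "r n \<in> measurable path_space (count_space UNIV)" for n
    unfolding r_def by measurable
  show ?thesis
  proof (rule borel_measurable_LIMSEQ_real)
    show "(\<lambda>w. w (real (r n w) / real (Suc n))) \<in> borel_measurable path_space" for n
      by (rule measurable_compose_countable[where f = "\<lambda>i w. w (real i / real (Suc n))"]) measurable
    fix w assume "w \<in> space path_space"
    then have c: "continuous_on {0..} w" by (simp add: space_path_space pathsD)
    have "(\<lambda>n. real (r n w) / real (Suc n)) \<longlonglongrightarrow> enn2real (R w)"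
    proof (rule tendsto_sandwich)
      have fl: "real (Suc n) * enn2real (R w) - 1 \<le> real (r n w)"
               "real (r n w) \<le> real (Suc n) * enn2real (R w)" for n
        unfolding r_def by (subst of_nat_nat; force | linarith)+
      show "\<forall>\<^sub>F n in sequentially. enn2real (R w) - 1 / real (Suc n) \<le> real (r n w) / real (Suc n)"
      proof (intro always_eventually allI)
        fix n
        show "enn2real (R w) - 1 / real (Suc n) \<le> real (r n w) / real (Suc n)"
          using divide_right_mono[OF fl(1), of "real (Suc n)" n]
          by (simp add: diff_divide_distrib del: of_nat_Suc)
      qed
      show "\<forall>\<^sub>F n in sequentially. real (r n w) / real (Suc n) \<le> enn2real (R w)"
      proof (intro always_eventually allI)
        fix n
        show "real (r n w) / real (Suc n) \<le> enn2real (R w)"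
          using divide_right_mono[OF fl(2), of "real (Suc n)" n] by (simp del: of_nat_Suc)
      qed
      show "(\<lambda>n. enn2real (R w) - 1 / real (Suc n)) \<longlonglongrightarrow> enn2real (R w)"
        using tendsto_diff[OF tendsto_const LIMSEQ_inverse_real_of_nat, of "enn2real (R w)"]
        by (simp add: inverse_eq_divide)
    qed simp
    from continuous_on_tendsto_compose[OF c this]
    show "(\<lambda>n. w (real (r n w) / real (Suc n))) \<longlonglongrightarrow> stopped_value R w"
      by (simp add: stopped_value_def)
  qed
qed

section \<open>Measurability and locality of stopping times\<close>

lemma stopping_time_measurable:
  assumes "stopping_time canonical_filtration R"
  shows "R \<in> borel_measurable path_space"
proof (rule borel_measurableI_le)
  fix t
  have "{w \<in> space path_space. R w \<le> t} = {w \<in> space (canonical_filtration t). R w \<le> t}"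
    by (simp add: space_path_space space_canonical_filtration)
  also have "\<dots> \<in> sets (canonical_filtration t)"
    using stopping_timeD[OF assms, of t] by (simp add: pred_def)
  also have "\<dots> \<subseteq> sets (canonical_filtration \<top>)"
    using filtration.sets_F_mono[OF filtration_canonical_filtration, of t \<top>] by simp
  finally show "{w \<in> space path_space. R w \<le> t} \<in> sets path_space"
    by (simp add: sets_canonical_filtration_top)
qed

text \<open>Agreement up to \<open>s\<close> decides membership in every generator, and this
  survives complements and countable unions.\<close>

lemma canonical_filtration_local:
  assumes "A \<in> sets (canonical_filtration s)" "v \<in> paths" "w \<in> paths"
    and "\<And>t. 0 \<le> t \<Longrightarrow> ennreal t \<le> s \<Longrightarrow> v t = w t"
  shows "v \<in> A \<longleftrightarrow> w \<in> A"
proof -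
  have "A \<in> sigma_sets paths {{w \<in> paths. w t \<in> A} | t A. 0 \<le> t \<and> ennreal t \<le> s \<and> A \<in> sets borel}"
    using assms(1) unfolding canonical_filtration_def by (subst (asm) sets_measure_of) auto
  then show ?thesis
    by induction (use assms(2-) in auto)
qed

text \<open>Used pathwise with \<open>s = times n w\<close>: changing a path only after that time
  cannot change whether \<open>S\<close> has occurred by then.\<close>

lemma stopping_time_local:
  assumes "stopping_time canonical_filtration S" "v \<in> paths" "w \<in> paths"
    and "\<And>t. 0 \<le> t \<Longrightarrow> ennreal t \<le> s \<Longrightarrow> v t = w t"
  shows "S v \<le> s \<longleftrightarrow> S w \<le> s"
proof -
  have "{w \<in> paths. S w \<le> s} \<in> sets (canonical_filtration s)"
    using stopping_timeD[OF assms(1), of s] by (simp add: pred_def space_canonical_filtration)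
  from canonical_filtration_local[OF this assms(2-4)] show ?thesis
    using assms(2,3) by simp
qed

section \<open>Reflections\<close>

lemma reflection_in_paths:
  assumes "w \<in> paths"
  shows "reflection R w \<in> paths"
proof -
  note w = pathsD[OF assms]
  have "continuous_on {0..} (reflection R w)"
  proof (cases "R w")
    case top
    then show ?thesis
      by (intro continuous_on_eq[OF w(1)]) (auto simp: reflection_def)
  next
    case (real r)
    have "continuous_on {0..} (\<lambda>t. if t \<le> r then w t else 2 * w r - w t)"
      by (rule continuous_on_cases_le)
         (auto intro!: continuous_intros continuous_on_subset[OF w(1)])
    then show ?thesis
      by (rule continuous_on_eq) (use real in \<open>auto simp: reflection_def stopped_value_def\<close>)
  qed
  moreover have "reflection R w 0 = 0" "reflection R w \<in> extensional {0..}"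
    using w(2) by (auto simp: reflection_def)
  ultimately show ?thesis by (auto simp: paths_def)
qed

lemma measurable_reflection:
  assumes [measurable]: "R \<in> borel_measurable path_space"
  shows "reflection R \<in> measurable path_space path_space"
proof (rule measurable_into_path_space)
  fix t :: real assume "0 \<le> t"
  then show "(\<lambda>w. reflection R w t) \<in> borel_measurable path_space"
    by (simp add: reflection_def)
qed (simp add: space_path_space reflection_in_paths)

section \<open>First passage times\<close>

text \<open>The starting time \<open>s\<close> itself counts. If there is no such time, in
  particular if \<open>s = \<top>\<close>, the infimum is \<open>\<top>\<close>.\<close>

definition passage :: "path \<Rightarrow> real set \<Rightarrow> ennreal \<Rightarrow> ennreal" where
  "passage w B s = (INF t\<in>{t. 0 \<le> t \<and> s \<le> ennreal t \<and> w t \<in> B}. ennreal t)"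

lemma passage_lower: "0 \<le> t \<Longrightarrow> s \<le> ennreal t \<Longrightarrow> w t \<in> B \<Longrightarrow> passage w B s \<le> ennreal t"
  unfolding passage_def by (rule INF_lower) simp

lemma passage_ge: "s \<le> passage w B s"
  unfolding passage_def by (rule INF_greatest) simp

text \<open>The preimage of a closed set under a continuous path is closed, so a finite infimum is a
  minimum.\<close>

lemma passage_attained:
  assumes "w \<in> paths" "closed B" "passage w B s = ennreal r" "0 \<le> r"
  shows "w r \<in> B"
proof -
  define D where "D = {t. 0 \<le> t \<and> s \<le> ennreal t \<and> w t \<in> B}"
  have "s \<noteq> \<top>" using passage_ge[of s w B] assms(3) by (auto simp: top_unique)
  then obtain s' where s: "s = ennreal s'" "0 \<le> s'" by (cases s) auto
  have "D = ({0..} \<inter> w -` B) \<inter> {s'..}" by (auto simp: D_def s)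
  then have "closed D"
    using continuous_closed_preimage[OF pathsD(1)[OF assms(1)] closed_atLeast assms(2)] by auto
  moreover have "D \<noteq> {}" using assms(3) by (auto simp: passage_def D_def[symmetric])
  moreover have bdd: "bdd_below D" by (rule bdd_belowI[of _ 0]) (auto simp: D_def)
  ultimately have in_D: "Inf D \<in> D" by (intro closed_contains_Inf)
  have "passage w B s = ennreal (Inf D)"
    unfolding passage_def D_def[symmetric]
    by (intro antisym INF_lower in_D INF_greatest ennreal_leI cInf_lower bdd)
  then have "r = Inf D" using assms(3,4) in_D by (auto simp: D_def)
  then show ?thesis using in_D by (auto simp: D_def)
qed

text \<open>Only the window from \<open>s\<close> to the passage time matters, since a finite
  passage is attained at its end. The target may change along with the path, so that a path can be
  compared with a translate of itself.\<close>

lemma passage_cong: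
  assumes "w \<in> paths" "closed B"
    and "\<And>t. 0 \<le> t \<Longrightarrow> s \<le> ennreal t \<Longrightarrow> ennreal t \<le> passage w B s \<Longrightarrow> v t \<in> B' \<longleftrightarrow> w t \<in> B"
  shows "passage v B' s = passage w B s"
proof (rule antisym)
  show "passage v B' s \<le> passage w B s"
  proof (cases "passage w B s")
    case (real r)
    then have "w r \<in> B" using passage_attained[OF assms(1,2)] by auto
    then show ?thesis
      using real assms(3)[of r] passage_ge[of s w B] passage_lower[of r s v B'] by auto
  qed simp
  have "passage w B s \<le> ennreal t" if "0 \<le> t" "s \<le> ennreal t" "v t \<in> B'" for t
    using that assms(3)[of t] passage_lower[of t s w B] by (cases "ennreal t \<le> passage w B s") auto
  then show "passage w B s \<le> passage v B' s"
    by (subst (2) passage_def, intro INF_greatest) auto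
qed

text \<open>Intermediate value theorem.\<close>

lemma passage_sphere_le:
  assumes "w \<in> paths" "0 \<le> r" "r \<le> t" "0 \<le> d" "d \<le> \<bar>w t - w r\<bar>"
  shows "passage w {w r - d, w r + d} (ennreal r) \<le> ennreal t"
proof -
  have c: "continuous_on {r..t} w"
    by (rule continuous_on_subset[OF pathsD(1)[OF assms(1)]]) (use assms(2) in auto)
  have "\<exists>x. r \<le> x \<and> x \<le> t \<and> w x \<in> {w r - d, w r + d}"
  proof (cases "w r \<le> w t")
    case True
    then show ?thesis using IVT'[of w r "w r + d" t] c assms by auto
  next
    case False
    then show ?thesis using IVT2'[of w t "w r - d" r] c assms by auto
  qed
  then obtain x where x: "r \<le> x" "x \<le> t" "w x \<in> {w r - d, w r + d}" by blast
  have "passage w {w r - d, w r + d} (ennreal r) \<le> ennreal x"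
    using x assms(2) by (intro passage_lower) (auto intro: ennreal_leI)
  also have "\<dots> \<le> ennreal t" using x by (intro ennreal_leI)
  finally show ?thesis .
qed

lemma hitting_time_min:
  "min (hitting_time c w) (hitting_time c' w) = passage w {c, c'} 0"
proof -
  have "{t. 0 \<le> t \<and> 0 \<le> ennreal t \<and> w t \<in> {c, c'}} = {t. 0 \<le> t \<and> w t = c} \<union> {t. 0 \<le> t \<and> w t = c'}"
    by auto
  then show ?thesis
    unfolding passage_def hitting_time_def by (simp only: INF_union inf_min)
qed

text \<open>Reverses the increments between \<open>s\<close> and \<open>u\<close> and keeps all
  others; the constants make the pieces fit together. If \<open>s\<close> or \<open>u\<close> is
  \<open>\<top>\<close>, the branches that would read the path there are never reached.\<close>

definition flip :: "ennreal \<Rightarrow> ennreal \<Rightarrow> path \<Rightarrow> path" where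
  "flip s u w = (\<lambda>t\<in>{0..}.
     if ennreal t \<le> s then w t
     else if ennreal t \<le> u then 2 * w (enn2real s) - w t
     else w t + 2 * w (enn2real s) - 2 * w (enn2real u))"

lemma flip_ext [simp]: "flip s u w \<in> extensional {0..}"
  by (simp add: flip_def)

section \<open>The odometer\<close>

locale exit_interval =
  fixes a b :: real
  assumes a_pos: "a > 0" and b_pos: "b > 0" and non_dyadic: "\<not> dyadic (a / (a + b))"
begin

section \<open>Positions and radii in \<open>]-a, b[\<close>\<close>

primrec pos :: "nat \<Rightarrow> real" where
  "pos 0 = 0"
| "pos (Suc n) = (if pos n + a < b - pos n then 2 * pos n + a else 2 * pos n - b)"

definition gap :: "nat \<Rightarrow> real" where
  "gap n = min (pos n + a) (b - pos n)"

definition dir :: "nat \<Rightarrow> real" where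
  "dir n = (if pos n + a < b - pos n then - 1 else 1)"

lemma pos_Suc: "pos (Suc n) = pos n - dir n * gap n"
  by (simp add: dir_def gap_def min_def)

lemma pos_exit: "pos n + dir n * gap n \<in> {- a, b}"
  by (auto simp: dir_def gap_def min_def)

text \<open>The relative position \<open>(pos n + a) / (a + b)\<close> follows the doubling map
  modulo 1.\<close>

lemma pos_shift: "\<exists>k::int. (pos n + a) / (a + b) = 2 ^ n * (a / (a + b)) - of_int k"
proof (induction n)
  case 0
  show ?case by (rule exI[of _ 0]) simp
next
  case (Suc n)
  then obtain k :: int where k: "(pos n + a) / (a + b) = 2 ^ n * (a / (a + b)) - of_int k" by blast
  have nz: "a + b \<noteq> 0" using a_pos b_pos by simp
  have "(pos (Suc n) + a) / (a + b) = 2 * ((pos n + a) / (a + b)) \<or>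
        (pos (Suc n) + a) / (a + b) = 2 * ((pos n + a) / (a + b)) - 1"
    using nz by (auto simp: field_simps)
  then show ?case
  proof
    assume "(pos (Suc n) + a) / (a + b) = 2 * ((pos n + a) / (a + b))"
    then show ?case unfolding k by (intro exI[of _ "2 * k"]) (simp add: algebra_simps)
  next
    assume "(pos (Suc n) + a) / (a + b) = 2 * ((pos n + a) / (a + b)) - 1"
    then show ?case unfolding k by (intro exI[of _ "2 * k + 1"]) (simp add: algebra_simps)
  qed
qed

text \<open>The endpoints have relative positions 0 and 1, and by \<open>pos_shift\<close> an
  integer relative position would make \<open>a / (a + b)\<close> dyadic. In particular the tie in
  \<open>pos\<close>, which would lead to \<open>- a\<close>, never occurs.\<close>

lemma pos_not_boundary: "pos n \<noteq> - a" "pos n \<noteq> b"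
proof -
  have s: "a + b \<noteq> 0" using a_pos b_pos by simp
  obtain k :: int where k: "(pos n + a) / (a + b) = 2 ^ n * (a / (a + b)) - of_int k"
    using pos_shift by blast
  have "(pos n + a) / (a + b) \<noteq> of_int j" for j :: int
  proof
    assume "(pos n + a) / (a + b) = of_int j"
    then have "2 ^ n * (a / (a + b)) = of_int (j + k)" using k by simp
    then have "a / (a + b) = of_int (j + k) / 2 ^ n" by (simp add: nonzero_eq_divide_eq mult.commute)
    then show False using non_dyadic unfolding dyadic_def by blast
  qed
  from this[of 0] this[of 1] s show "pos n \<noteq> - a" "pos n \<noteq> b" by (auto simp: add.commute)
qed

lemma pos_bounds: "- a < pos n \<and> pos n < b"
proof (induction n)
  case 0
  show ?case using a_pos b_pos by simp
next
  case (Suc n)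
  then show ?case using pos_not_boundary[of "Suc n"] by auto
qed

lemma gap_pos: "0 < gap n"
  using pos_bounds[of n] by (simp add: gap_def)

lemma gap_le: "2 * gap n \<le> a + b"
  by (simp add: gap_def min_def)

text \<open>Moving away from the nearer endpoint doubles the distance to it; below half the length
  of the interval, that endpoint remains the nearer one.\<close>

lemma gap_double: "4 * gap n < a + b \<Longrightarrow> gap (Suc n) = 2 * gap n"
  by (auto simp: gap_def min_def split: if_splits)

lemma gap_not_tendsto_0: "\<not> gap \<longlonglongrightarrow> 0"
proof
  assume lim: "gap \<longlonglongrightarrow> 0"
  have "eventually (\<lambda>n. gap n < (a + b) / 4) sequentially"
    using order_tendstoD(2)[OF lim, of "(a + b) / 4"] a_pos b_pos by simp
  then obtain N where N: "\<And>n. n \<ge> N \<Longrightarrow> gap n < (a + b) / 4"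
    by (auto simp: eventually_sequentially)
  \<comment> \<open>If the radii stayed small from \<open>N\<close> on, they would double at every
    step and so stay above the positive number \<open>gap N\<close>.\<close>
  have "gap N \<le> gap n" if "n \<ge> N" for n
    using that
  proof (induction n rule: dec_induct)
    case (step n)
    then show ?case using gap_double[of n] N[of n] gap_pos[of n] by simp
  qed simp
  then have "gap N \<le> 0"
    using LIMSEQ_le_const[OF lim] by blast
  then show False using gap_pos[of N] by simp
qed

section \<open>Cutting times and exit times\<close>

primrec times :: "nat \<Rightarrow> path \<Rightarrow> ennreal" where
  "times 0 w = 0"
| "times (Suc n) w =
    passage w {w (enn2real (times n w)) - gap n, w (enn2real (times n w)) + gap n} (times n w)"

text \<open>For \<open>n = 0\<close> this is the hitting time of \<open>{- a, b}\<close>; in general it is the first exit from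
  \<open>]-a, b[\<close> after the path has been translated to be at \<open>pos n\<close> at \<open>times n\<close>.\<close>

definition exit_time :: "nat \<Rightarrow> path \<Rightarrow> ennreal" where
  "exit_time n w =
    passage w {w (enn2real (times n w)) - pos n - a, w (enn2real (times n w)) - pos n + b} (times n w)"

text \<open>Hence, once a time is \<open>\<top>\<close>, all later ones are, and the default centre
  \<open>w 0\<close> that \<open>enn2real \<top>\<close> then gives in \<open>times\<close> is
  harmless.\<close>

lemma times_mono: "times n w \<le> times (Suc n) w"
  by (simp add: passage_ge)

text \<open>\<open>gap n\<close> is the distance from \<open>pos n\<close> to the nearer endpoint,
  so an exit requires a displacement of at least \<open>gap n\<close>.\<close>

lemma times_le_exit:
  assumes "w \<in> paths"
  shows "times (Suc n) w \<le> exit_time n w"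
proof (cases "times n w")
  case (real r)
  have "times (Suc n) w \<le> ennreal t"
    if "0 \<le> t" "ennreal r \<le> ennreal t" "w t \<in> {w r - pos n - a, w r - pos n + b}" for t
    using that real gap_pos[of n] pos_bounds[of n] passage_sphere_le[OF assms, of r t "gap n"]
    by (auto simp: gap_def)
  then show ?thesis
    using real unfolding exit_time_def by (subst passage_def, intro INF_greatest) auto
next
  case top
  then show ?thesis using passage_ge[of "times n w"] unfolding exit_time_def by (metis top_unique top_greatest)
qed

lemma times_SucD:
  assumes "w \<in> paths" "times n w = ennreal r" "0 \<le> r" "times (Suc n) w = ennreal r'" "0 \<le> r'"
  shows "r \<le> r'" "w r' = w r + dir n * gap n \<or> w r' = w r - dir n * gap n"
proof -
  show "r \<le> r'" using times_mono[of n w] assms by simp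
  have "w r' \<in> {w r - gap n, w r + gap n}"
    using assms by (intro passage_attained[OF assms(1)]) auto
  then show "w r' = w r + dir n * gap n \<or> w r' = w r - dir n * gap n"
    by (auto simp: dir_def)
qed

lemma exit_time_eq:
  assumes "w \<in> paths" "times n w = ennreal r" "0 \<le> r" "times (Suc n) w = ennreal r'" "0 \<le> r'"
    and "w r' = w r + dir n * gap n"
  shows "exit_time n w = times (Suc n) w"
proof (rule antisym)
  have "w r' \<in> {w r - pos n - a, w r - pos n + b}"
    using pos_exit[of n] assms(6) by auto
  then show "exit_time n w \<le> times (Suc n) w"
    unfolding exit_time_def assms(4) using assms times_SucD(1)[OF assms(1-5)]
    by (intro passage_lower) auto
qed (rule times_le_exit[OF assms(1)])

text \<open>A step away from the nearer endpoint leads from \<open>pos n\<close> to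
  \<open>pos (Suc n)\<close>, so both exit times use the same translation of the path, and no exit
  occurs before \<open>times (Suc n)\<close>.\<close>

lemma exit_time_Suc:
  assumes "w \<in> paths" "times n w = ennreal r" "0 \<le> r" "times (Suc n) w = ennreal r'" "0 \<le> r'"
    and "w r' = w r - dir n * gap n"
  shows "exit_time n w = exit_time (Suc n) w"
proof -
  have eq: "w r - pos n = w r' - pos (Suc n)" using assms(6) pos_Suc[of n] by simp
  have "times (Suc n) w \<le> ennreal t"
    if "0 \<le> t" "times n w \<le> ennreal t" "w t \<in> {w r - pos n - a, w r - pos n + b}" for t
    using times_le_exit[OF assms(1), of n] assms(2,3)
      passage_lower[of t "times n w" w "{w r - pos n - a, w r - pos n + b}", OF that]
    unfolding exit_time_def by (simp del: times.simps)
  then have "{t. 0 \<le> t \<and> times n w \<le> ennreal t \<and> w t \<in> {w r - pos n - a, w r - pos n + b}} =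
      {t. 0 \<le> t \<and> times (Suc n) w \<le> ennreal t \<and> w t \<in> {w r - pos n - a, w r - pos n + b}}"
    using order_trans[OF times_mono[of n w]] by blast
  moreover have "enn2real (times n w) = r" "enn2real (times (Suc n) w) = r'"
    using assms(2-5) by simp_all
  ultimately show ?thesis
    unfolding exit_time_def passage_def by (simp only: eq)
qed

text \<open>Galmarino's property for \<open>times n\<close>, by induction along the successive
  passages.\<close>

lemma times_cong:
  assumes "w \<in> paths" "\<And>t. 0 \<le> t \<Longrightarrow> ennreal t \<le> times n w \<Longrightarrow> v t = w t"
  shows "times n v = times n w"
  using assms(2)
proof (induction n)
  case (Suc n)
  have IH: "times n v = times n w"
    using Suc.prems times_mono[of n w] by (intro Suc.IH) (meson order_trans)
  show ?case
  proof (cases "times n w")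
    case top
    then show ?thesis using IH times_mono[of n v] times_mono[of n w] by (metis top_unique)
  next
    case (real r)
    then have "v r = w r" using Suc.prems[of r] times_mono[of n w] by auto
    then show ?thesis
      using IH real Suc.prems by (simp, intro passage_cong[OF assms(1)]) auto
  qed
qed simp

text \<open>The \<open>2^n\<close>-th iterate of the odometer.\<close>

definition \<sigma> :: "nat \<Rightarrow> path \<Rightarrow> path" where
  "\<sigma> n w = flip (times n w) (exit_time n w) w"

lemma \<sigma>_before: "0 \<le> t \<Longrightarrow> ennreal t \<le> times n w \<Longrightarrow> \<sigma> n w t = w t"
  by (simp add: \<sigma>_def flip_def)

lemma \<sigma>_between:
  assumes "w \<in> paths" "times n w = ennreal r" "0 \<le> r" "r \<le> t" "ennreal t \<le> times (Suc n) w"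
  shows "\<sigma> n w t = 2 * w r - w t"
proof -
  have "ennreal t \<le> exit_time n w" using assms times_le_exit[OF assms(1), of n] by order
  then show ?thesis using assms by (auto simp: \<sigma>_def flip_def)
qed

lemma times_\<sigma>: "w \<in> paths \<Longrightarrow> times n (\<sigma> n w) = times n w"
  by (rule times_cong) (simp_all add: \<sigma>_before)

text \<open>Until \<open>times (Suc n)\<close> the path is reflected about its value at
  \<open>times n\<close>, the centre of the two-point target, which is thus preserved.\<close>

lemma times_Suc_\<sigma>:
  assumes "w \<in> paths"
  shows "times (Suc n) (\<sigma> n w) = times (Suc n) w"
proof (cases "times n w")
  case top
  then show ?thesis using times_\<sigma>[OF assms, of n] times_mono[of n] by (metis top_unique)
next
  case (real r)
  have r: "\<sigma> n w r = w r" using real by (simp add: \<sigma>_before)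
  have "\<sigma> n w t \<in> {w r - gap n, w r + gap n} \<longleftrightarrow> w t \<in> {w r - gap n, w r + gap n}"
    if "0 \<le> t" "ennreal r \<le> ennreal t" "ennreal t \<le> times (Suc n) w" for t
    using \<sigma>_between[OF assms, of n r t] real that by auto
  then show ?thesis
    using real r times_\<sigma>[OF assms, of n] by (simp, intro passage_cong[OF assms]) auto
qed

text \<open>One carry of a binary odometer: of two consecutive applications of \<open>\<sigma> n\<close>, exactly one
  flips beyond \<open>times (Suc n)\<close>, namely the one that finds the \<open>n\<close>-th increment directed away from
  the boundary point nearest to \<open>pos n\<close>.\<close>

lemma \<sigma>_\<sigma>:
  assumes w: "w \<in> paths" and \<sigma>w: "\<sigma> n w \<in> paths"
  shows "\<sigma> n (\<sigma> n w) = \<sigma> (Suc n) w"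
proof (rule paths_eqI)
  fix t :: real assume t: "0 \<le> t"
  define v where "v = \<sigma> n w"
  have v: "v \<in> paths" using \<sigma>w by (simp add: v_def)
  have Tn: "times n v = times n w" and Tn1: "times (Suc n) v = times (Suc n) w"
    unfolding v_def by (rule times_\<sigma>[OF w] times_Suc_\<sigma>[OF w])+
  have "\<sigma> n v t = \<sigma> (Suc n) w t"
  proof (cases "times (Suc n) w")
    case top
    \<comment> \<open>Without a next time there is no exit either, so both applications reverse
      everything after \<open>times n\<close> and cancel.\<close>
    then have [simp]: "exit_time n w = \<top>" "exit_time n v = \<top>"
      using times_le_exit[OF w, of n] times_le_exit[OF v, of n] Tn1 by (auto simp: top_unique)
    show ?thesis
    proof (cases "times n w")
      case T: (real r)
      have "v r = w r" unfolding v_def using T by (simp add: \<sigma>_before)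
      then show ?thesis using T top Tn t
        by (auto simp: \<sigma>_def[of "Suc n"] \<sigma>_def[of n v] flip_def simp del: times.simps)
           (auto simp: v_def \<sigma>_def flip_def simp del: times.simps)
    next
      case T: top
      then show ?thesis using top Tn t
        by (simp add: \<sigma>_before v_def del: times.simps)
    qed
  next
    case R': (real r')
    then have "times n w \<noteq> \<top>" using times_mono[of n w] by (auto simp: top_unique simp del: times.simps)
    then obtain r where R: "times n w = ennreal r" "0 \<le> r" by (cases "times n w") auto
    have R'v: "times (Suc n) v = ennreal r'" and Rv: "times n v = ennreal r"
      using R' R Tn Tn1 by auto
    have rr': "r \<le> r'" using times_SucD(1)[OF w R(1,2) R'(2,1)] .
    have vr: "v r = w r" unfolding v_def using R by (simp add: \<sigma>_before)
    have vr': "v r' = 2 * w r - w r'"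
      unfolding v_def using R R' rr' by (intro \<sigma>_between[OF w]) (auto simp del: times.simps)
    from times_SucD(2)[OF w R(1,2) R'(2,1)] show ?thesis
    proof
      \<comment> \<open>The increment exits: the first application reverses it alone. In
        \<open>v\<close> it points away, so the second application reverses it back and continues up
        to the exit time for \<open>Suc n\<close>.\<close>
      assume dirn: "w r' = w r + dir n * gap n"
      have E: "exit_time n w = ennreal r'" using exit_time_eq[OF w R(1,2) R'(2,1) dirn] R'(2) by simp
      have vt: "v t = (if t \<le> r then w t else if t \<le> r' then 2 * w r - w t else w t + 2 * w r - 2 * w r')"
        if "0 \<le> t" for t
        using that E R R' by (simp add: v_def \<sigma>_def flip_def)
      have "exit_time n v = exit_time (Suc n) v"
        using exit_time_Suc[OF v Rv R(2) R'v R'(1)] dirn vr vr' by simp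
      also have "\<dots> = exit_time (Suc n) w"
      proof -
        \<comment> \<open>Beyond \<open>r'\<close> the paths \<open>v\<close> and \<open>w\<close>
          differ by a constant, so exits relative to their values at \<open>r'\<close>
          coincide.\<close>
        have "v t \<in> {v r' - pos (Suc n) - a, v r' - pos (Suc n) + b} \<longleftrightarrow>
              w t \<in> {w r' - pos (Suc n) - a, w r' - pos (Suc n) + b}"
          if "0 \<le> t" "ennreal r' \<le> ennreal t" for t
        proof -
          have "v t - v r' = w t - w r'"
            using that vt[of t] vt[of r'] rr' R'(1) R(2) by (auto split: if_splits)
          then show ?thesis by auto
        qed
        then show ?thesis
          unfolding exit_time_def using R' R'v
          by (simp only: enn2real_ennreal, intro passage_cong[OF w]) auto
      qed
      finally have Ev: "exit_time n v = exit_time (Suc n) w" .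
      show ?thesis
      proof (cases "exit_time (Suc n) w")
        case (real u)
        have "r' \<le> u"
          using passage_ge[of "times (Suc n) w"] real R' unfolding exit_time_def by (metis ennreal_le_iff)
        then show ?thesis
          using t real R R' Rv Ev vt[of t] vt[of u] vr rr'
          by (simp add: \<sigma>_def flip_def del: times.simps)
      next
        case top
        then show ?thesis
          using t R R' Rv Ev vt[of t] vr rr'
          by (simp add: \<sigma>_def flip_def del: times.simps)
      qed
    next
      \<comment> \<open>The increment points away: the first application reverses through to the
        exit time for \<open>Suc n\<close>. In \<open>v\<close> the increment exits, so the second
        application only restores it.\<close>
      assume dirn: "w r' = w r - dir n * gap n"
      have E: "exit_time n w = exit_time (Suc n) w"
        using exit_time_Suc[OF w R(1,2) R'(2,1) dirn] .
      have Ev: "exit_time n v = ennreal r'"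
        using exit_time_eq[OF v Rv R(2) R'v R'(1)] dirn vr vr' R'v by simp
      show ?thesis
      proof (cases "exit_time (Suc n) w")
        case (real u)
        have "r' \<le> u"
          using passage_ge[of "times (Suc n) w"] real R' unfolding exit_time_def by (metis ennreal_le_iff)
        moreover have "v t = (if t \<le> r then w t else if t \<le> u then 2 * w r - w t else w t + 2 * w r - 2 * w u)"
          using t E R real by (simp add: v_def \<sigma>_def flip_def)
        ultimately show ?thesis
          using t real R R' Rv Ev vr vr' rr'
          by (simp add: \<sigma>_def flip_def del: times.simps)
      next
        case top
        have "v t = (if t \<le> r then w t else 2 * w r - w t)"
          using t E R top by (simp add: v_def \<sigma>_def flip_def)
        then show ?thesis
          using t top R R' Rv Ev vr vr' rr'
          by (simp add: \<sigma>_def flip_def del: times.simps)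
      qed
    qed
  qed
  then show "\<sigma> n (\<sigma> n w) t = \<sigma> (Suc n) w t" by (simp add: v_def)
qed (simp_all add: \<sigma>_def)

text \<open>Reflecting at \<open>T\<close> and then negating gives \<open>- w\<close> up to
  \<open>T\<close> and \<open>w - 2 * w T\<close> afterwards, which is a flip between 0 and
  \<open>T\<close> because \<open>w 0 = 0\<close>.\<close>

lemma \<sigma>_0:
  assumes "w \<in> paths"
  shows "\<sigma> 0 w = reflection (\<lambda>w. 0) (reflection (\<lambda>w. min (hitting_time (- a) w) (hitting_time b w)) w)"
proof (rule paths_eqI)
  fix t :: real assume "0 \<le> t"
  then show "\<sigma> 0 w t =
      reflection (\<lambda>w. 0) (reflection (\<lambda>w. min (hitting_time (- a) w) (hitting_time b w)) w) t"
    using pathsD(2)[OF assms]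
    by (auto simp: \<sigma>_def flip_def reflection_def stopped_value_def exit_time_def hitting_time_min)
qed (simp_all add: \<sigma>_def reflection_def)

section \<open>The odometer times are measurable and unbounded\<close>

text \<open>Reduces the passage to countably many conditions, for measurability. The margin
  \<open>1 / Suc m\<close> allows for a passage at an irrational time.\<close>

lemma times_Suc_le_iff:
  assumes w: "w \<in> paths" and t: "0 \<le> t"
  shows "times (Suc n) w \<le> ennreal t \<longleftrightarrow>
    (\<forall>m::nat. \<exists>q::rat. 0 \<le> real_of_rat q \<and> of_rat q \<le> t \<and> times n w \<le> ennreal (of_rat q) \<and>
      gap n - 1 / Suc m < \<bar>w (of_rat q) - stopped_value (times n) w\<bar>)"
    (is "_ \<longleftrightarrow> (\<forall>m. ?P m)")
proof
  assume le: "times (Suc n) w \<le> ennreal t"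
  then obtain r' where R': "times (Suc n) w = ennreal r'" "0 \<le> r'"
    by (cases "times (Suc n) w") (auto simp: top_unique simp del: times.simps)
  then obtain r where R: "times n w = ennreal r" "0 \<le> r"
    using times_mono[of n w] by (cases "times n w") (auto simp: top_unique simp del: times.simps)
  have r: "r \<le> r'" "\<bar>w r' - w r\<bar> = gap n"
    using times_SucD[OF w R R'] gap_pos[of n] by (auto simp: dir_def split: if_splits)
  \<comment> \<open>This leaves room for a rational time between \<open>r\<close> and
    \<open>r'\<close>.\<close>
  then have "r < r'" using gap_pos[of n] by (cases "r = r'") auto
  show "\<forall>m. ?P m"
  proof
    fix m :: nat
    have "continuous_on {0..} (\<lambda>x. \<bar>w x - w r\<bar>)"
      using pathsD(1)[OF w] by (intro continuous_intros)
    then have "((\<lambda>x. \<bar>w x - w r\<bar>) \<longlongrightarrow> \<bar>w r' - w r\<bar>) (at r' within {0..})"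
      using R'(2) by (auto simp: continuous_on_def)
    then have "eventually (\<lambda>x. gap n - 1 / Suc m < \<bar>w x - w r\<bar>) (at r' within {0..})"
      by (rule order_tendstoD) (simp add: r)
    then obtain e where e: "e > 0"
      "\<And>x. 0 \<le> x \<Longrightarrow> x \<noteq> r' \<Longrightarrow> dist x r' < e \<Longrightarrow> gap n - 1 / Suc m < \<bar>w x - w r\<bar>"
      by (auto simp: eventually_at)
    obtain q where q: "max r (r' - e) < of_rat q" "of_rat q < r'"
      using of_rat_dense[of "max r (r' - e)" r'] \<open>r < r'\<close> e(1) by auto
    moreover have "0 \<le> real_of_rat q" using q R(2) by linarith
    moreover have "r' \<le> t" using le R' t by (simp del: times.simps)
    ultimately show "?P m"
      using e(2)[of "of_rat q"] R
      by (intro exI[of _ q])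
         (auto simp: dist_real_def stopped_value_def simp del: times.simps zero_le_of_rat_iff
           intro: ennreal_leI)
  qed
next
  assume P: "\<forall>m. ?P m"
  from P[rule_format, of 0] obtain r where R: "times n w = ennreal r" "0 \<le> r"
    by (cases "times n w") (auto simp: top_unique)
  from P[rule_format, of 0] R have rt: "r \<le> t" by auto
  \<comment> \<open>By compactness one time \<open>x\<close> maximises the displacement; it serves
    for all \<open>m\<close> at once.\<close>
  have "continuous_on {r..t} (\<lambda>x. \<bar>w x - w r\<bar>)"
    using R(2) by (intro continuous_intros continuous_on_subset[OF pathsD(1)[OF w]]) auto
  then obtain x where x: "x \<in> {r..t}" "\<And>y. y \<in> {r..t} \<Longrightarrow> \<bar>w y - w r\<bar> \<le> \<bar>w x - w r\<bar>"
    using continuous_attains_sup[of "{r..t}" "\<lambda>x. \<bar>w x - w r\<bar>"] rt by auto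
  have "gap n - 1 / Suc m \<le> \<bar>w x - w r\<bar>" for m
  proof -
    from P[rule_format, of m] obtain q where q: "0 \<le> real_of_rat q" "of_rat q \<le> t" 
      "times n w \<le> ennreal (of_rat q)" "gap n - 1 / Suc m < \<bar>w (of_rat q) - stopped_value (times n) w\<bar>"
      by blast
    then have "of_rat q \<in> {r..t}" using R by auto
    from x(2)[OF this] show ?thesis using q(4) R by (simp add: stopped_value_def)
  qed
  moreover have "(\<lambda>m. gap n - 1 / real (Suc m)) \<longlonglongrightarrow> gap n"
    using tendsto_diff[OF tendsto_const LIMSEQ_inverse_real_of_nat, of "gap n"]
    by (simp add: inverse_eq_divide)
  ultimately have "gap n \<le> \<bar>w x - w r\<bar>"
    by (intro LIMSEQ_le_const2) auto
  then have "times (Suc n) w \<le> ennreal x"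
    using passage_sphere_le[OF w R(2), of x "gap n"] x(1) gap_pos[of n] R by auto
  also have "\<dots> \<le> ennreal t" using x by (intro ennreal_leI) auto
  finally show "times (Suc n) w \<le> ennreal t" .
qed

lemma measurable_times [measurable]: "times n \<in> borel_measurable path_space"
proof (induction n)
  case (Suc n)
  note [measurable] = Suc
  show ?case
  proof (rule borel_measurableI_le)
    fix y :: ennreal
    show "{w \<in> space path_space. times (Suc n) w \<le> y} \<in> sets path_space"
    proof (cases y)
      case (real t)
      have "{w \<in> space path_space. times (Suc n) w \<le> y} = {w \<in> space path_space.
        \<forall>m::nat. \<exists>q::rat. 0 \<le> real_of_rat q \<and> of_rat q \<le> t \<and> times n w \<le> ennreal (of_rat q) \<and>
          gap n - 1 / Suc m < \<bar>w (of_rat q) - stopped_value (times n) w\<bar>}"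
        unfolding real(2) using times_Suc_le_iff[OF _ real(1)]
        by (intro Collect_cong conj_cong refl) (simp only: space_path_space)
      also have "\<dots> \<in> sets path_space" by measurable
      finally show ?thesis .
    qed simp
  qed
qed simp

text \<open>At a finite accumulation point of the times, continuity would force the increments, of
  size \<open>gap n\<close>, to tend to 0.\<close>

lemma times_unbounded:
  assumes w: "w \<in> paths" and t: "t < \<top>"
  shows "\<exists>n. t < times n w"
proof (rule ccontr)
  assume "\<nexists>n. t < times n w"
  then have le: "times n w \<le> t" for n by (meson not_less)
  define r where "r n = enn2real (times n w)" for n
  have R: "times n w = ennreal (r n)" "0 \<le> r n" for n
    using le[of n] t unfolding r_def by (auto simp: ennreal_enn2real_if top_unique)
  have inc: "incseq r"
    by (intro incseq_SucI) (use times_SucD(1)[OF w R R] in blast)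
  have "r n \<le> enn2real t" for n
    unfolding r_def using le[of n] t by (rule enn2real_mono)
  with inc obtain L where L: "r \<longlonglongrightarrow> L"
    using incseq_convergent[of r "enn2real t"] by blast
  have L0: "0 \<le> L" using LIMSEQ_le_const[OF L] R by auto
  have wL: "(\<lambda>n. w (r n)) \<longlonglongrightarrow> w L"
    by (rule continuous_on_tendsto_compose[OF pathsD(1)[OF w] L]) (use L0 R in auto)
  have "(\<lambda>n. \<bar>w (r (Suc n)) - w (r n)\<bar>) \<longlonglongrightarrow> \<bar>w L - w L\<bar>"
    by (intro tendsto_intros wL LIMSEQ_Suc)
  moreover have "\<bar>w (r (Suc n)) - w (r n)\<bar> = gap n" for n
    using times_SucD(2)[OF w R R, of n] gap_pos[of n] by (auto simp: dir_def split: if_splits)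
  ultimately show False using gap_not_tendsto_0 by simp
qed

section \<open>The approximating martingale\<close>

text \<open>The increment of the martingale stopped at the first of the \<open>times\<close> not
  before \<open>S\<close>. If there is no next time, the martingale keeps its last value.\<close>

definition incr :: "(path \<Rightarrow> ennreal) \<Rightarrow> nat \<Rightarrow> path \<Rightarrow> real" where
  "incr S n w = (if times n w < S w \<and> times (Suc n) w < \<top>
     then stopped_value (times (Suc n)) w - stopped_value (times n) w else 0)"

lemma incr_bound:
  assumes "w \<in> paths"
  shows "\<bar>incr S n w\<bar> \<le> gap n"
proof (cases "times (Suc n) w")
  case R': (real r')
  then obtain r where R: "times n w = ennreal r" "0 \<le> r"
    using times_mono[of n w] by (cases "times n w") (auto simp: top_unique simp del: times.simps)
  show ?thesis
    using times_SucD(2)[OF assms R R'(2,1)] gap_pos[of n] R R'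
    by (auto simp: incr_def stopped_value_def dir_def simp del: times.simps split: if_splits)
qed (use gap_pos[of n] in \<open>simp add: incr_def del: times.simps\<close>)

lemma measurable_incr [measurable]:
  assumes [measurable]: "S \<in> borel_measurable path_space"
  shows "incr S n \<in> borel_measurable path_space"
  unfolding incr_def by (simp del: times.simps)

text \<open>\<open>\<sigma> n\<close> keeps the path up to \<open>times n\<close>, hence the event
  that \<open>S\<close> is still to come; it also keeps \<open>times (Suc n)\<close> and reverses
  the increment in between.\<close>

lemma incr_\<sigma>:
  assumes w: "w \<in> paths" and v: "\<sigma> n w \<in> paths" and S: "stopping_time canonical_filtration S"
  shows "incr S n (\<sigma> n w) = - incr S n w"
proof -
  have S_eq: "times n w < S (\<sigma> n w) \<longleftrightarrow> times n w < S w"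
    using stopping_time_local[OF S v w, of "times n w"] \<sigma>_before by (simp add: not_le[symmetric])
  show ?thesis
  proof (cases "times (Suc n) w")
    case R': (real r')
    then obtain r where R: "times n w = ennreal r" "0 \<le> r"
      using times_mono[of n w] by (cases "times n w") (auto simp: top_unique simp del: times.simps)
    have "\<sigma> n w r' = 2 * w r - w r'"
      using R R' times_SucD(1)[OF w R R'(2,1)] by (intro \<sigma>_between[OF w]) auto
    moreover have "\<sigma> n w r = w r" using R by (simp add: \<sigma>_before)
    ultimately show ?thesis
      using S_eq R R' times_\<sigma>[OF w, of n] times_Suc_\<sigma>[OF w, of n]
      by (simp add: incr_def stopped_value_def del: times.simps)
  next
    case top
    then show ?thesis using times_Suc_\<sigma>[OF w, of n] by (simp add: incr_def del: times.simps)
  qed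
qed

section \<open>Distance between the stopped martingale and \<open>X_S\<close>\<close>

lemma path_near_times:
  assumes "w \<in> paths" "times n w < s" "s \<le> times (Suc n) w" "s < \<top>"
  shows "\<bar>w (enn2real s) - w (enn2real (times n w))\<bar> \<le> gap n"
proof -
  obtain r where R: "times n w = ennreal r" "0 \<le> r"
    using assms(2) by (cases "times n w") auto
  obtain t where T: "s = ennreal t" "0 \<le> t" using assms(4) by (cases s) auto
  have "r \<le> t" using assms(2) R T by (simp add: ennreal_less_iff)
  show ?thesis
  proof (rule ccontr)
    assume "\<not> ?thesis"
    then have big: "gap n < \<bar>w t - w r\<bar>" using R T by simp
    then have "times (Suc n) w \<le> ennreal t"
      using passage_sphere_le[OF assms(1) R(2) \<open>r \<le> t\<close>, of "gap n"] gap_pos[of n] R by simp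
    \<comment> \<open>So \<open>t\<close> is the passage time itself, where the displacement is
      exactly \<open>gap n\<close>.\<close>
    then have "times (Suc n) w = ennreal t" using assms(3) T by order
    from times_SucD(2)[OF assms(1) R this T(2)] big gap_pos[of n] show False
      by (auto simp: dir_def split: if_splits)
  qed
qed

text \<open>Before \<open>S\<close> the sum telescopes, and after \<open>S\<close> it is frozen. In
  the step that passes \<open>S\<close>, both the path at \<open>S\<close> and the new value are
  within \<open>gap n\<close> of the old one, and \<open>2 * gap n \<le> a + b\<close>.\<close>

lemma sum_incr:
  assumes w: "w \<in> paths" and S: "S w < \<top>"
  shows "(times n w < S w \<longrightarrow> (\<Sum>k<n. incr S k w) = stopped_value (times n) w) \<and>
    (S w \<le> times n w \<longrightarrow> \<bar>stopped_value S w - (\<Sum>k<n. incr S k w)\<bar> \<le> a + b)"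
proof (induction n)
  case 0
  show ?case using pathsD(2)[OF w] a_pos b_pos by (auto simp: stopped_value_def)
next
  case (Suc n)
  show ?case
  proof (cases "times n w < S w")
    case True
    then have sum: "(\<Sum>k<Suc n. incr S k w) = stopped_value (times n) w + incr S n w"
      using Suc by simp
    have "(\<Sum>k<Suc n. incr S k w) = stopped_value (times (Suc n)) w" if "times (Suc n) w < S w"
    proof -
      have "times (Suc n) w < \<top>" using that S by order
      then show ?thesis unfolding sum using True by (simp add: incr_def del: times.simps)
    qed
    moreover have "\<bar>stopped_value S w - (\<Sum>k<Suc n. incr S k w)\<bar> \<le> a + b" if "S w \<le> times (Suc n) w"
    proof -
      have "\<bar>stopped_value S w - stopped_value (times n) w\<bar> \<le> gap n"
        unfolding stopped_value_def by (rule path_near_times[OF w True that S])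
      then show ?thesis unfolding sum using incr_bound[OF w, of S n] gap_le[of n] by linarith
    qed
    ultimately show ?thesis by blast
  next
    case False
    then have "S w \<le> times n w" "S w \<le> times (Suc n) w" using times_mono[of n w] by order+
    then show ?thesis using Suc by (auto simp: incr_def simp del: times.simps)
  qed
qed

section \<open>Invariance of \<open>Q\<close> and passage to the limit\<close>

lemma \<sigma>_preserves:
  assumes Q: "sets Q = sets path_space"
    and 0: "(\<lambda>w. 0) \<in> preserving_times Q"
    and T: "(\<lambda>w. min (hitting_time (- a) w) (hitting_time b w)) \<in> preserving_times Q"
  shows "\<sigma> n \<in> measurable path_space path_space \<and> distr Q path_space (\<sigma> n) = Q"
proof -
  note mc = measurable_cong_sets[OF Q refl]
  have comp: "f \<in> measurable path_space path_space \<and> distr Q path_space f = Q"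
    if g: "g \<in> measurable path_space path_space" "distr Q path_space g = Q"
      and h: "h \<in> measurable path_space path_space" "distr Q path_space h = Q"
      and f: "\<And>w. w \<in> paths \<Longrightarrow> f w = h (g w)" for f g h :: "path \<Rightarrow> path"
  proof
    have "h \<circ> g \<in> measurable path_space path_space" using g h by (intro measurable_comp)
    then show "f \<in> measurable path_space path_space"
      by (subst measurable_cong[where g = "h \<circ> g"]) (auto simp: f space_path_space)
    have "distr Q path_space f = distr Q path_space (h \<circ> g)"
      by (intro distr_cong) (auto simp: f sets_eq_imp_space_eq[OF Q] space_path_space)
    also have "\<dots> = distr (distr Q path_space g) path_space h"
      using g h by (subst distr_distr) (simp_all add: mc)
    finally show "distr Q path_space f = Q" using g h by simp
  qed
  show ?thesis
  \<comment> \<open>\<open>\<sigma> 0\<close> is a product of two maps preserving \<open>Q\<close>,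
    and \<open>\<sigma> (Suc n)\<close> is the square of \<open>\<sigma> n\<close>.\<close>
  proof (induction n)
    case 0
    show ?case
      using assms(2,3) unfolding preserving_times_def
      by (intro comp[of "reflection (\<lambda>w. min (hitting_time (- a) w) (hitting_time b w))"
            "reflection (\<lambda>w. 0)"] measurable_reflection stopping_time_measurable \<sigma>_0) auto
  next
    case (Suc n)
    \<comment> \<open>Continuity of \<open>\<sigma> n w\<close> is contained in the measurability of
      \<open>\<sigma> n\<close> into \<open>path_space\<close>.\<close>
    have "\<sigma> n w \<in> paths" if "w \<in> paths" for w
      using measurable_space[OF conjunct1[OF Suc]] that by (simp add: space_path_space)
    with Suc show ?case by (intro comp[of "\<sigma> n" "\<sigma> n"]) (auto simp: \<sigma>_\<sigma>)
  qed
qed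

text \<open>The partial sums of \<open>incr\<close> have mean 0 and are within \<open>a + b\<close>
  of \<open>X_S\<close> unless \<open>times n\<close> is before \<open>S\<close>. The probability of
  this exception tends to 0, and the uniform bound controls its contribution.\<close>

theorem expectation_bound:
  assumes "prob_space Q" and Q: "sets Q = sets path_space"
    and zero: "(\<lambda>w. 0) \<in> preserving_times Q"
    and T: "(\<lambda>w. min (hitting_time (- a) w) (hitting_time b w)) \<in> preserving_times Q"
    and S: "stopping_time canonical_filtration S"
    and fin: "finite_time S" and bdd: "stopped_uniformly_bounded S"
  shows "\<bar>prob_space.expectation Q (stopped_value S)\<bar> \<le> a + b"
proof -
  interpret prob_space Q by fact
  have spQ: "space Q = paths" using sets_eq_imp_space_eq[OF Q] by (simp add: space_path_space)
  have mQ: "f \<in> borel_measurable Q" if "f \<in> borel_measurable path_space"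
    for f :: "path \<Rightarrow> 'x :: topological_space"
    using that by (simp add: measurable_cong_sets[OF Q refl])
  have Sm [measurable]: "S \<in> borel_measurable path_space" by (rule stopping_time_measurable[OF S])
  have int_incr: "integrable Q (incr S n)" for n
    by (rule integrable_const_bound[of _ "gap n"]) (auto simp: spQ incr_bound intro!: mQ)
  have incr_0: "expectation (incr S n) = 0" for n
  proof -
    note \<sigma> = \<sigma>_preserves[OF Q zero T, of n]
    \<comment> \<open>Invariance under \<open>\<sigma> n\<close> and \<open>incr_\<sigma>\<close>
      make the expectation equal to its own negative.\<close>
    have "expectation (incr S n) = integral\<^sup>L (distr Q path_space (\<sigma> n)) (incr S n)"
      using \<sigma> by simp
    also have "\<dots> = expectation (\<lambda>w. incr S n (\<sigma> n w))"
      using \<sigma> by (intro integral_distr) (simp_all add: measurable_cong_sets[OF Q refl])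
    also have "\<dots> = expectation (\<lambda>w. - incr S n w)"
      using measurable_space[OF conjunct1[OF \<sigma>]]
      by (intro Bochner_Integration.integral_cong refl incr_\<sigma> S) (auto simp: spQ space_path_space)
    finally show ?thesis by simp
  qed
  \<comment> \<open>These events decrease to the empty set, since \<open>S\<close> is finite and the
    \<open>times\<close> are unbounded.\<close>
  define B where "B n = {w \<in> paths. times n w < S w}" for n
  have Bm: "B n \<in> events" for n
  proof -
    have "{w \<in> space path_space. times n w < S w} \<in> sets path_space" by measurable
    then show ?thesis by (simp add: B_def Q space_path_space)
  qed
  have "(\<lambda>n. prob (B n)) \<longlonglongrightarrow> prob (\<Inter>n. B n)"
  proof (rule finite_Lim_measure_decseq)
    show "decseq B"
      using times_mono by (intro decseq_SucI) (auto simp: B_def simp del: times.simps intro: le_less_trans)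
  qed (use Bm in auto)
  moreover have "(\<Inter>n. B n) = {}"
  proof -
    have "w \<notin> (\<Inter>n. B n)" for w
    proof
      assume B: "w \<in> (\<Inter>n. B n)"
      then have "w \<in> paths" by (simp add: B_def)
      with fin times_unbounded[of w "S w"] obtain n where "S w < times n w"
        by (auto simp: finite_time_def)
      moreover have "times n w < S w" using B unfolding B_def by blast
      ultimately show False by order
    qed
    then show ?thesis by blast
  qed
  ultimately have B0: "(\<lambda>n. prob (B n)) \<longlonglongrightarrow> 0" by simp
  obtain C where C: "\<And>w t. w \<in> paths \<Longrightarrow> 0 \<le> t \<Longrightarrow>
      \<bar>stopped_value (\<lambda>w. min (ennreal t) (S w)) w\<bar> \<le> C"
    using bdd unfolding stopped_uniformly_bounded_def by blast
  \<comment> \<open>On \<open>B n\<close> this bounds the path at both \<open>S\<close> and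
    \<open>times n\<close>, whence the error \<open>2 * C\<close> there.\<close>
  have C': "\<bar>w (enn2real s)\<bar> \<le> C" if "w \<in> paths" "s \<le> S w" for s w
  proof -
    have "s < \<top>" using that fin unfolding finite_time_def by (meson le_less_trans)
    then show ?thesis
      using C[OF that(1), of "enn2real s"] that(2) by (simp add: stopped_value_def min_def)
  qed
  have int_S: "integrable Q (stopped_value S)"
    by (rule integrable_const_bound[of _ C]) (auto simp: spQ stopped_value_def C' intro!: mQ)
  have "\<bar>expectation (stopped_value S)\<bar> \<le> a + b + 2 * C * prob (B n)" for n
  proof -
    define Z where "Z w = (\<Sum>k<n. incr S k w)" for w
    have int_Z: "integrable Q Z" "expectation Z = 0"
      using int_incr incr_0 unfolding Z_def by (simp_all add: Bochner_Integration.integral_sum)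
    have "\<bar>expectation (stopped_value S)\<bar> = \<bar>expectation (\<lambda>w. stopped_value S w - Z w)\<bar>"
      using int_S int_Z by simp
    also have "\<dots> \<le> expectation (\<lambda>w. \<bar>stopped_value S w - Z w\<bar>)"
      by (rule integral_abs_bound)
    also have "\<dots> \<le> expectation (\<lambda>w. (a + b) + 2 * C * indicator (B n) w)"
    proof (rule integral_mono)
      fix w assume "w \<in> space Q"
      then have w: "w \<in> paths" by (simp add: spQ)
      show "\<bar>stopped_value S w - Z w\<bar> \<le> a + b + 2 * C * indicator (B n) w"
      proof (cases "times n w < S w")
        case True
        then have "Z w = w (enn2real (times n w))"
          using sum_incr[OF w, of S n] fin w by (simp add: finite_time_def Z_def stopped_value_def)
        moreover have "\<bar>w (enn2real (S w))\<bar> \<le> C" "\<bar>w (enn2real (times n w))\<bar> \<le> C"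
          using True by (auto intro!: C'[OF w])
        moreover have "indicator (B n) w = (1 :: real)" using True w by (simp add: B_def)
        ultimately show ?thesis using a_pos b_pos unfolding stopped_value_def by simp
      next
        case False
        then show ?thesis
          using sum_incr[OF w, of S n] fin w by (auto simp: finite_time_def B_def Z_def)
      qed
    qed (use int_S int_Z Bm in \<open>auto intro!: integrable_abs integrable_diff integrable_add
          integrable_mult_right integrable_real_indicator simp: less_top[symmetric]\<close>)
    also have "\<dots> = a + b + 2 * C * prob (B n)"
      using Bm by (simp add: prob_space less_top[symmetric])
    finally show ?thesis .
  qed
  moreover have "(\<lambda>n. a + b + 2 * C * prob (B n)) \<longlonglongrightarrow> a + b + 2 * C * 0"
    by (intro tendsto_intros B0)
  ultimately show ?thesis
    by (intro LIMSEQ_le_const[where X = "\<lambda>n. a + b + 2 * C * prob (B n)"]) auto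
qed

end

theorem proposition1:
  fixes a b :: real and Q :: "path measure" and S :: "path \<Rightarrow> ennreal"
  assumes "a > 0" and "b > 0" and "\<not> dyadic (a / (a + b))"
    and "prob_space Q" and "sets Q = sets path_space"
    and "(\<lambda>w. 0) \<in> preserving_times Q"
    and "(\<lambda>w. min (hitting_time (- a) w) (hitting_time b w)) \<in> preserving_times Q"
    and "stopping_time canonical_filtration S"
    and "finite_time S" and "stopped_uniformly_bounded S"
  shows "\<bar>prob_space.expectation Q (stopped_value S)\<bar> \<le> a + b"
proof -
  interpret exit_interval a b
    by unfold_locales fact+
  show ?thesis by (rule expectation_bound) fact+
qed

end
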